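(* Let $\ell<n$ be positive integers and let $d$ be a real number with $\ell<d<n$. Let $(c_j)_{j\ge 1}$ and $(r_j)_{j\ge 1}$ be sequences of positive real numbers such that $\sum_{j} c_j r_j^d<+\infty$ and, for every $\varepsilon>0$, $c_j r_j^{d-\varepsilon}\to+\infty$ as $j\to+\infty$. Let $K=\bigcup_{j\ge 1} K_j$ be a union of pairwise disjoint sets $K_j\subset\mathbb{R}^n$, where each $K_j$ is a $d$-set with $\mathrm{diam}(K_j)\le r_j$ and $m_d(K_j)=c_j r_j^d$. For each $\pi\in G(n,\ell)$, let $\Pi:\mathbb{R}^n\to\pi$ be the orthogonal projection onto $\pi$ and let $\mu_\pi=\Pi_*(m_d\restriction_K)$ be the push-forward to $\pi$ of the restriction of $m_d$ to $K$. Then $K$ is a $d$-set with $0<m_d(K)<+\infty$, and for every $\pi\in G(n,\ell)$ such that the Radon-Nikodym derivative $d\mu_\pi/dm_\ell$ exists (that is, such that $\mu_\pi$ is absolutely continuous with respect to the $\ell$-dimensional Lebesgue measure $m_\ell$ on $\pi$), the function $d\mu_\pi/dm_\ell$ is not in $L^p(\pi,m_\ell)$ for any $p>1$.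
   Context: For $U\subset\mathbb{R}^n$, the diameter of $U$ is $|U|=\mathrm{diam}(U)=\sup\{|x-y| : x,y\in U\}$. For a family $\mathcal{U}$ of subsets of $\mathbb{R}^n$, put $\|\mathcal{U}\|=\sup_{U\in\mathcal{U}}|U|$. For $d>0$, the Hausdorff $d$-measure of $K\subset\mathbb{R}^n$ is $$m_d(K)=\lim_{\varepsilon\to 0}\ \inf\Big\{\sum_{U\in\mathcal{U}}|U|^d : \mathcal{U}\text{ is a countable cover of }K\text{ with }\|\mathcal{U}\|<\varepsilon\Big\}$$ (no normalizing constant is included). The Hausdorff dimension $\mathrm{HD}(K)$ is the unique $d_0\ge 0$ such that $m_d(K)=\infty$ for $d<d_0$ and $m_d(K)=0$ for $d>d_0$. A Borel set $K\subset\mathbb{R}^n$ is called a $d$-set if $\mathrm{HD}(K)=d$ and $0<m_d(K)<\infty$. $G(n,\ell)$ denotes the Grassmannian of $\ell$-dimensional planes (linear subspaces) in $\mathbb{R}^n$ containing the origin. For $\pi\in G(n,\ell)$, $m_\ell$ denotes the $\ell$-dimensional Lebesgue measure on $\pi$. *)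

theory Defs
  imports "HOL-Analysis.Analysis"
begin

section \<open>Hausdorff measure, Hausdorff dimension and \<open>d\<close>-sets\<close>

text \<open>
  The library's \<^const>\<open>diameter\<close> is real-valued and unspecified for unbounded sets.  A set of
  infinite diameter can never belong to a cover of finite mesh, so boundedness of the members
  is made explicit.
\<close>

definition mesh :: "'a::metric_space set set \<Rightarrow> ennreal" where
  "mesh \<U> = (SUP U\<in>\<U>. ennreal (diameter U))"

definition fine_covers :: "real \<Rightarrow> 'a::metric_space set \<Rightarrow> 'a set set set" where
  "fine_covers \<epsilon> K =
     {\<U>. countable \<U> \<and> K \<subseteq> \<Union>\<U> \<and> (\<forall>U\<in>\<U>. bounded U) \<and> mesh \<U> < ennreal \<epsilon>}"

definition hausdorff_premeasure :: "real \<Rightarrow> real \<Rightarrow> 'a::metric_space set \<Rightarrow> ennreal" where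
  "hausdorff_premeasure d \<epsilon> K =
     (INF \<U>\<in>fine_covers \<epsilon> K. \<Sum>\<^sub>\<infinity>U\<in>\<U>. ennreal (diameter U powr d))"

definition hausdorff :: "real \<Rightarrow> 'a::metric_space set \<Rightarrow> ennreal" where
  "hausdorff d K = Lim (at_right 0) (\<lambda>\<epsilon>. hausdorff_premeasure d \<epsilon> K)"

text \<open>The limit defining \<^const>\<open>hausdorff\<close> exists, by monotonicity in \<open>\<epsilon>\<close>.\<close>

lemma hausdorff_premeasure_antimono:
  assumes "\<epsilon> \<le> \<delta>"
  shows "hausdorff_premeasure d \<delta> K \<le> hausdorff_premeasure d \<epsilon> K"
  unfolding hausdorff_premeasure_def
proof (rule INF_superset_mono)
  show "fine_covers \<epsilon> K \<subseteq> fine_covers \<delta> K"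
    using ennreal_leI[OF assms] unfolding fine_covers_def by (auto intro: less_le_trans)
qed simp

lemma tendsto_hausdorff_premeasure:
  "((\<lambda>\<epsilon>. hausdorff_premeasure d \<epsilon> K) \<longlongrightarrow> (SUP \<epsilon>\<in>{0<..}. hausdorff_premeasure d \<epsilon> K)) (at_right 0)"
proof (rule order_tendstoI)
  fix a assume "a < (SUP \<epsilon>\<in>{0<..}. hausdorff_premeasure d \<epsilon> K)"
  then obtain \<delta> where \<delta>: "\<delta> > 0" "a < hausdorff_premeasure d \<delta> K"
    by (auto simp: less_SUP_iff)
  show "\<forall>\<^sub>F \<epsilon> in at_right 0. a < hausdorff_premeasure d \<epsilon> K"
    unfolding eventually_at_right_field
    using \<delta> by (meson hausdorff_premeasure_antimono less_imp_le less_le_trans)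
next
  fix a assume a: "(SUP \<epsilon>\<in>{0<..}. hausdorff_premeasure d \<epsilon> K) < a"
  have "hausdorff_premeasure d \<epsilon> K < a" if "\<epsilon> > 0" for \<epsilon>
    using that by (intro le_less_trans[OF SUP_upper a]) simp
  then show "\<forall>\<^sub>F \<epsilon> in at_right 0. hausdorff_premeasure d \<epsilon> K < a"
    unfolding eventually_at_right_field by (auto intro: exI[of _ 1])
qed

lemma hausdorff_eq_SUP:
  "hausdorff d K = (SUP \<epsilon>\<in>{0<..}. hausdorff_premeasure d \<epsilon> K)"
  unfolding hausdorff_def
  by (rule tendsto_Lim[OF _ tendsto_hausdorff_premeasure]) simp

definition hausdorff_dim :: "'a::metric_space set \<Rightarrow> real" where
  "hausdorff_dim K = (THE d0. 0 \<le> d0 \<and>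
     (\<forall>d. 0 < d \<and> d < d0 \<longrightarrow> hausdorff d K = \<infinity>) \<and> (\<forall>d>d0. hausdorff d K = 0))"

definition d_set :: "real \<Rightarrow> 'a::metric_space set \<Rightarrow> bool" where
  "d_set d K \<longleftrightarrow> K \<in> sets borel \<and> hausdorff_dim K = d \<and> 0 < hausdorff d K \<and> hausdorff d K < \<infinity>"

text \<open>
  The outer measure \<^term>\<open>hausdorff d\<close> as a measure on the Borel sets, where it is countably
  additive by Caratheodory's criterion.
\<close>

definition hausdorff_measure :: "real \<Rightarrow> 'a::metric_space measure" where
  "hausdorff_measure d = measure_of UNIV (sets borel) (hausdorff d)"


section \<open>Linear subspaces: Grassmannian, orthogonal projection, Lebesgue measure\<close>

definition grassmannian :: "nat \<Rightarrow> 'a::euclidean_space set set" where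
  "grassmannian l = {\<pi>. subspace \<pi> \<and> dim \<pi> = l}"

definition orth_projection :: "'a::euclidean_space set \<Rightarrow> 'a \<Rightarrow> 'a" where
  "orth_projection \<pi> x = (THE y. y \<in> \<pi> \<and> (\<forall>z\<in>\<pi>. orthogonal (x - y) z))"

definition orthonormal_basis_of :: "'a::euclidean_space set \<Rightarrow> 'a set \<Rightarrow> bool" where
  "orthonormal_basis_of \<pi> B \<longleftrightarrow>
     pairwise orthogonal B \<and> (\<forall>b\<in>B. norm b = 1) \<and> span B = \<pi>"

text \<open>
  Lebesgue measure on a subspace \<open>\<pi>\<close> is defined in the same way as \<^const>\<open>lborel\<close>: the product of
  one-dimensional Lebesgue measures in the coordinates of an orthonormal basis, on the Borel sets
  of \<open>\<pi>\<close>.  By invariance under orthogonal maps the choice of the basis is immaterial.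
\<close>

definition subspace_lborel :: "'a::euclidean_space set \<Rightarrow> 'a measure" where
  "subspace_lborel \<pi> = (let B = (SOME B. orthonormal_basis_of \<pi> B) in
     distr (\<Pi>\<^sub>M b\<in>B. (lborel :: real measure)) (restrict_space borel \<pi>) (\<lambda>f. \<Sum>b\<in>B. f b *\<^sub>R b))"

lemma orthonormal_basis_of_exists:
  assumes "subspace \<pi>"
  shows "\<exists>B. orthonormal_basis_of \<pi> B"
  using orthonormal_basis_subspace[OF assms] unfolding orthonormal_basis_of_def by metis

definition projected_measure :: "real \<Rightarrow> 'a::euclidean_space set \<Rightarrow> 'a set \<Rightarrow> 'a measure" where
  "projected_measure d K \<pi> =
     distr (restrict_space (hausdorff_measure d) K) (restrict_space borel \<pi>) (orth_projection \<pi>)"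


section \<open>\<open>L\<^sup>p\<close> functions\<close>

definition in_Lp :: "real \<Rightarrow> 'a measure \<Rightarrow> ('a \<Rightarrow> real) \<Rightarrow> bool" where
  "in_Lp p M f \<longleftrightarrow> f \<in> borel_measurable M \<and> integrable M (\<lambda>x. \<bar>f x\<bar> powr p)"

end

theory Submission
  imports Defs
begin

text \<open>
  Caratheodory's criterion for metric outer measures makes \<open>m\<^sub>d\<close> countably additive on Borel
  sets, and \<open>0 < m\<^sub>d K < \<infinity>\<close> forces the dimension to be \<open>d\<close>.  The projection of \<open>K\<^sub>j\<close> lies in
  a cube \<open>Q\<^sub>j\<close> of \<open>\<pi>\<close> of side \<open>2 r\<^sub>j\<close>, whose \<open>\<mu>\<^sub>\<pi>\<close>-mass is therefore at least \<open>c\<^sub>j r\<^sub>j\<^sup>d\<close>.  A density in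
  \<open>L\<^sup>p\<close> would bound that mass by a constant times \<open>m\<^sub>l(Q\<^sub>j)\<close> to the power \<open>1 - 1/p\<close>, so
  \<open>c\<^sub>j r\<^sub>j\<^bsup>d - e\<^esup>\<close> would stay bounded for \<open>e = l (1 - 1/p) > 0\<close>.
\<close>

section \<open>Sums of extended nonnegative reals\<close>

lemma sum_le_infsum_ennreal:
  fixes f :: "'a \<Rightarrow> ennreal"
  assumes "finite F" "F \<subseteq> A"
  shows "sum f F \<le> infsum f A"
  using assms by (subst nonneg_infsum_complete) (auto intro: SUP_upper)

lemma infsum_ennreal_le:
  fixes f :: "'a \<Rightarrow> ennreal"
  assumes "\<And>F. finite F \<Longrightarrow> F \<subseteq> A \<Longrightarrow> sum f F \<le> c"
  shows "infsum f A \<le> c"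
  using assms by (subst nonneg_infsum_complete) (auto intro: SUP_least)

text \<open>The sets \<open>U n\<close> may overlap, so each point of a finite \<open>F\<close> is
  charged to every \<open>n\<close> with \<open>U n\<close> containing it, which happens at least
  once. Exchanging the finite sum with the series then gives the bound. It is meant for merging
  countably many covers into one.\<close>

lemma infsum_UN_le_suminf:
  fixes f :: "'a \<Rightarrow> ennreal" and U :: "nat \<Rightarrow> 'a set"
  shows "infsum f (\<Union>n. U n) \<le> (\<Sum>n. infsum f (U n))"
proof (rule infsum_ennreal_le)
  fix F assume F: "finite F" "F \<subseteq> (\<Union>n. U n)"
  have "sum f F \<le> (\<Sum>x\<in>F. \<Sum>n. f x * indicator (U n) x)"
  proof (rule sum_mono)
    fix x assume "x \<in> F"
    then obtain m where "x \<in> U m" using F by auto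
    then have "f x \<le> (\<Sum>n\<in>{m}. f x * indicator (U n) x)" by simp
    also have "\<dots> \<le> (\<Sum>n. f x * indicator (U n) x)"
      by (rule sum_le_suminf) auto
    finally show "f x \<le> (\<Sum>n. f x * indicator (U n) x)" .
  qed
  also have "\<dots> = (\<Sum>n. \<Sum>x\<in>F. f x * indicator (U n) x)"
    by (rule suminf_sum[symmetric]) auto
  also have "\<dots> \<le> (\<Sum>n. infsum f (U n))"
  proof (rule suminf_le)
    fix n
    have "(\<Sum>x\<in>F. f x * indicator (U n) x) = sum f (F \<inter> U n)"
      using F(1) by (simp add: sum.inter_restrict indicator_def if_distrib cong: if_cong)
    also have "\<dots> \<le> infsum f (U n)"
      using F(1) by (intro sum_le_infsum_ennreal) auto
    finally show "(\<Sum>x\<in>F. f x * indicator (U n) x) \<le> infsum f (U n)" .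
  qed auto
  finally show "sum f F \<le> (\<Sum>n. infsum f (U n))" .
qed

lemma infsum_ennreal_Un_disjoint_le:
  fixes f :: "'a \<Rightarrow> ennreal"
  assumes "A \<inter> B = {}" "A \<subseteq> C" "B \<subseteq> C"
  shows "infsum f A + infsum f B \<le> infsum f C"
proof -
  have "infsum f A + infsum f B = infsum f (A \<union> B)"
    using assms by (intro infsum_Un_disjoint[symmetric]) (auto intro: nonneg_summable_on_complete)
  also have "\<dots> \<le> infsum f C"
    using assms by (intro infsum_mono_neutral) (auto intro: nonneg_summable_on_complete)
  finally show ?thesis .
qed

section \<open>Metric outer measures\<close>

lemma sigma_algebra_UNIV: "sigma_algebra UNIV (UNIV :: 'a set set)"
  using sigma_algebra_Pow[of "UNIV :: 'a set"] by simp

text \<open>Additivity on sets at positive distance is required only as superadditivity; the other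
  inequality follows from \<open>empty\<close> and \<open>UN_le\<close>.\<close>

locale metric_outer_measure =
  fixes \<mu> :: "'a::metric_space set \<Rightarrow> ennreal"
  assumes empty: "\<mu> {} = 0"
    and mono: "A \<subseteq> B \<Longrightarrow> \<mu> A \<le> \<mu> B"
    and UN_le: "\<mu> (\<Union>n. X n) \<le> (\<Sum>n::nat. \<mu> (X n))"
    and separated: "0 < e \<Longrightarrow> (\<And>x y. x \<in> A \<Longrightarrow> y \<in> B \<Longrightarrow> e \<le> dist x y) \<Longrightarrow> \<mu> A + \<mu> B \<le> \<mu> (A \<union> B)"
begin

lemma outer: "outer_measure_space UNIV \<mu>"
  using empty mono UN_le
  by (auto simp: outer_measure_space_def positive_def increasing_def countably_subadditive_def)

lemma Un_le: "\<mu> (A \<union> B) \<le> \<mu> A + \<mu> B"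
proof -
  interpret sigma_algebra UNIV "UNIV :: 'a set set" by (rule sigma_algebra_UNIV)
  have "subadditive UNIV \<mu>"
    using outer countably_subadditive_subadditive unfolding outer_measure_space_def by blast
  then have "\<mu> (A \<union> (B - A)) \<le> \<mu> A + \<mu> (B - A)"
    by (rule subadditiveD) auto
  also have "\<dots> \<le> \<mu> A + \<mu> B" by (intro add_left_mono mono) auto
  finally show ?thesis by simp
qed

text \<open>The gap \<open>e\<close> may depend on \<open>k\<close>, since induction only compares
  each new set with the union of the earlier ones.\<close>

lemma sum_separated_le:
  fixes D :: "nat \<Rightarrow> 'a set"
  assumes "\<And>k. \<exists>e>0. \<forall>x\<in>(\<Union>j<k. D j). \<forall>y\<in>D k. e \<le> dist x y"
  shows "(\<Sum>j<k. \<mu> (D j)) \<le> \<mu> (\<Union>j<k. D j)"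
proof (induction k)
  case (Suc k)
  obtain e where e: "e > 0" "\<forall>x\<in>(\<Union>j<k. D j). \<forall>y\<in>D k. e \<le> dist x y"
    using assms by blast
  have "(\<Sum>j<Suc k. \<mu> (D j)) \<le> \<mu> (\<Union>j<k. D j) + \<mu> (D k)"
    using Suc by (simp add: add_right_mono)
  also have "\<dots> \<le> \<mu> ((\<Union>j<k. D j) \<union> D k)"
    using e by (intro separated) auto
  also have "(\<Union>j<k. D j) \<union> D k = (\<Union>j<Suc k. D j)"
    by (auto simp: less_Suc_eq)
  finally show ?case .
qed (simp add: empty)

text \<open>The sets \<open>E n\<close> exhaust \<open>A - F\<close> and have positive distance from
  \<open>F\<close>, so they add up correctly with \<open>A \<inter> F\<close>. What
  \<open>E n\<close> misses lies in thin shells around \<open>F\<close>; the masses of the shells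
  have a finite sum, so the missing part tends to zero.\<close>

lemma closed_measurable:
  assumes F: "closed F"
  shows "F \<in> lambda_system UNIV UNIV \<mu>"
proof -
  interpret sigma_algebra UNIV "UNIV :: 'a set set" by (rule sigma_algebra_UNIV)
  have "\<mu> (A \<inter> F) + \<mu> (A - F) = \<mu> A" for A
  proof (rule antisym)
    show "\<mu> A \<le> \<mu> (A \<inter> F) + \<mu> (A - F)"
      using Un_le[of "A \<inter> F" "A - F"] by (simp add: Un_Diff_Int Int_Diff_Un)
    show "\<mu> (A \<inter> F) + \<mu> (A - F) \<le> \<mu> A"
    \<comment> \<open>The empty set is set apart because \<open>infdist x {}\<close> is
      \<open>0\<close> by convention, and infinite \<open>\<mu> A\<close> because the argument
      subtracts in \<open>ennreal\<close>.\<close>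
    proof (cases "F = {} \<or> \<mu> A = \<infinity>")
      case True
      then show ?thesis by (auto simp: empty)
    next
      case False
      then have ne: "F \<noteq> {}" and fin: "\<mu> A \<noteq> \<infinity>" by auto
      define E where "E n = {x\<in>A. 1 / real (Suc n) \<le> infdist x F}" for n
      define D where "D n = {x\<in>A. 1 / real (Suc (Suc n)) \<le> infdist x F \<and> infdist x F < 1 / real (Suc n)}" for n
      have inv_mono: "1 / real (Suc n) \<le> 1 / real (Suc m)" if "m \<le> n" for m n
        using that by (intro divide_left_mono) auto
      have E_add: "\<mu> (A \<inter> F) + \<mu> (E n) \<le> \<mu> A" for n
      proof -
        have "\<mu> (A \<inter> F) + \<mu> (E n) \<le> \<mu> ((A \<inter> F) \<union> E n)"
        proof (rule separated[of "1 / real (Suc n)"])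
          fix x y assume "x \<in> A \<inter> F" "y \<in> E n"
          then have "1 / real (Suc n) \<le> infdist y F" "infdist y F \<le> dist y x"
            by (auto simp: E_def intro: infdist_le)
          then show "1 / real (Suc n) \<le> dist x y" by (simp add: dist_commute)
        qed simp
        also have "\<dots> \<le> \<mu> A" by (rule mono) (auto simp: E_def)
        finally show ?thesis .
      qed
      \<comment> \<open>Consecutive shells may touch, but shells two indices apart are separated, so the even
        and the odd shells are treated in turn.\<close>
      have D_sum: "(\<Sum>j<k. \<mu> (D (2 * j + i))) \<le> \<mu> A" for i k
      proof -
        have "(\<Sum>j<k. \<mu> (D (2 * j + i))) \<le> \<mu> (\<Union>j<k. D (2 * j + i))"
        proof (rule sum_separated_le)
          fix k
          \<comment> \<open>For \<open>j < k\<close> the shell with index \<open>2 * j + i\<close>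
            stays at distance at least \<open>1 / (2 * k + i)\<close> from \<open>F\<close>, while
            the shell with index \<open>2 * k + i\<close> stays below
            \<open>1 / (2 * k + i + 1)\<close>. The case \<open>k = 0\<close> is separate: the union
            is empty, and \<open>e\<close> would be negative for \<open>i = 0\<close>, as
            \<open>1 / 0 = 0\<close>.\<close>
          define e where "e = 1 / real (2 * k + i) - 1 / real (Suc (2 * k + i))"
          show "\<exists>e>0. \<forall>x\<in>\<Union>j<k. D (2 * j + i). \<forall>y\<in>D (2 * k + i). e \<le> dist x y"
          proof (cases "k = 0")
            case True then show ?thesis by (auto intro: exI[of _ 1])
          next
            case False
            then have "0 < 2 * k + i" by simp
            then have "e > 0"
              unfolding e_def by (simp add: frac_less2 del: of_nat_add of_nat_Suc)
            moreover have "e \<le> dist x y" if "j < k" "x \<in> D (2 * j + i)" "y \<in> D (2 * k + i)" for x y j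
            proof -
              have "1 / real (2 * k + i) \<le> 1 / real (Suc (Suc (2 * j + i)))"
                using that(1) by (intro divide_left_mono) auto
              also have "\<dots> \<le> infdist x F" using that(2) by (simp add: D_def)
              finally show ?thesis
                using that(3) infdist_triangle[of x F y] by (auto simp: D_def e_def)
            qed
            ultimately show ?thesis by auto
          qed
        qed
        also have "\<dots> \<le> \<mu> A" by (rule mono) (auto simp: D_def)
        finally show ?thesis .
      qed
      have D_sum_all: "(\<Sum>n<k. \<mu> (D n)) \<le> \<mu> A + \<mu> A" for k
      proof -
        have "(\<Sum>n<k. \<mu> (D n)) \<le> (\<Sum>n<2 * k. \<mu> (D n))"
          by (rule sum_mono2) auto
        \<comment> \<open>Doubling the range lets the sum split into exactly \<open>k\<close> even
          and \<open>k\<close> odd shells.\<close>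
        also have "\<dots> = (\<Sum>j<k. \<mu> (D (2 * j + 0))) + (\<Sum>j<k. \<mu> (D (2 * j + 1)))"
          by (induction k) (auto simp: algebra_simps)
        also have "\<dots> \<le> \<mu> A + \<mu> A"
          by (intro add_mono D_sum)
        finally show ?thesis .
      qed
      have "(\<Sum>n. \<mu> (D n)) \<le> \<mu> A + \<mu> A"
        by (rule suminf_le_const[OF summableI D_sum_all])
      then have S_fin: "(\<Sum>n. \<mu> (D n)) \<noteq> \<infinity>"
        using fin by (auto simp: top_unique)
      have split: "\<mu> (A - F) \<le> \<mu> (E n) + (\<Sum>k. \<mu> (D (k + n)))" for n
      proof -
        have "A - F \<subseteq> E n \<union> (\<Union>k. D (k + n))"
        proof
          fix x assume x: "x \<in> A - F"
          then have pos: "infdist x F > 0"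
            using F ne infdist_pos_not_in_closed by fastforce
          then obtain m where m: "1 / real (Suc m) < infdist x F"
            using nat_approx_posE by blast
          define P where "P m \<longleftrightarrow> 1 / real (Suc m) \<le> infdist x F" for m
          have Pm: "P m" using m by (simp add: P_def)
          show "x \<in> E n \<union> (\<Union>k. D (k + n))"
          proof (cases "P n")
            case True then show ?thesis using x by (auto simp: E_def P_def)
          next
            case False
            \<comment> \<open>\<open>P\<close> is upward closed, so if \<open>P n\<close> fails, the
              first index \<open>q\<close> with \<open>P q\<close> exceeds \<open>n\<close>, and
              \<open>x\<close> lies in the shell just before it.\<close>
            define q where "q = (LEAST m. P m)"
            have q: "P q" "\<And>j. j < q \<Longrightarrow> \<not> P j"
              using Pm LeastI not_less_Least unfolding q_def by metis+
            have "n < q"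
            proof (rule ccontr)
              assume "\<not> n < q"
              then have "P n" using q(1) inv_mono[of q n] unfolding P_def by simp
              with False show False by simp
            qed
            then obtain k where k: "q = Suc (k + n)"
              by (metis add.commute less_imp_Suc_add)
            then have "x \<in> D (k + n)"
              using q(1) q(2)[of "k + n"] x by (auto simp: D_def P_def)
            then show ?thesis by auto
          qed
        qed
        then have "\<mu> (A - F) \<le> \<mu> (E n \<union> (\<Union>k. D (k + n)))" by (rule mono)
        also have "\<dots> \<le> \<mu> (E n) + \<mu> (\<Union>k. D (k + n))" by (rule Un_le)
        also have "\<dots> \<le> \<mu> (E n) + (\<Sum>k. \<mu> (D (k + n)))"
          by (intro add_left_mono UN_le)
        finally show ?thesis .
      qed
      \<comment> \<open>The tail of the series is written as a difference so that the limit in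
        \<open>n\<close> can be taken; finiteness of the sum makes the subtraction legitimate and
        the limit zero.\<close>
      have "\<mu> (A \<inter> F) + \<mu> (A - F) \<le> \<mu> A + ((\<Sum>k. \<mu> (D k)) - (\<Sum>k<n. \<mu> (D k)))" for n
      proof -
        have "(\<Sum>k. \<mu> (D k)) = (\<Sum>k. \<mu> (D (k + n))) + (\<Sum>k<n. \<mu> (D k))"
          by (rule suminf_offset) simp
        moreover have "(\<Sum>k<n. \<mu> (D k)) \<noteq> \<infinity>"
          using order.strict_trans1[OF D_sum_all, of \<infinity> n] fin by (simp add: less_top)
        ultimately have tail: "(\<Sum>k. \<mu> (D (k + n))) = (\<Sum>k. \<mu> (D k)) - (\<Sum>k<n. \<mu> (D k))"
          by (simp add: ennreal_add_diff_cancel_right)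
        have "\<mu> (A \<inter> F) + \<mu> (A - F) \<le> \<mu> (A \<inter> F) + (\<mu> (E n) + (\<Sum>k. \<mu> (D (k + n))))"
          by (intro add_left_mono split)
        also have "\<dots> \<le> \<mu> A + (\<Sum>k. \<mu> (D (k + n)))"
          using E_add[of n] by (simp add: add.assoc[symmetric] add_right_mono)
        finally show ?thesis unfolding tail .
      qed
      moreover have "(\<lambda>n. \<mu> A + ((\<Sum>k. \<mu> (D k)) - (\<Sum>k<n. \<mu> (D k)))) \<longlonglongrightarrow> \<mu> A + ((\<Sum>k. \<mu> (D k)) - (\<Sum>k. \<mu> (D k)))"
        using S_fin by (intro tendsto_intros tendsto_diff_ennreal summable_LIMSEQ summableI) auto
      ultimately have "\<mu> (A \<inter> F) + \<mu> (A - F) \<le> \<mu> A + ((\<Sum>k. \<mu> (D k)) - (\<Sum>k. \<mu> (D k)))"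
        by (intro LIMSEQ_le_const) auto
      then show ?thesis using S_fin by (simp add: ennreal_minus_cancel_iff)
    qed
  qed
  then show ?thesis by (simp add: lambda_system_eq)
qed

text \<open>The Caratheodory-measurable sets form a sigma-algebra on which \<open>\<mu>\<close> is a
  measure, and the closed sets in it generate the Borel sets.\<close>

lemma countably_additive_borel: "countably_additive (sets borel) \<mu>"
proof -
  interpret sigma_algebra UNIV "UNIV :: 'a set set" by (rule sigma_algebra_UNIV)
  have ms: "measure_space UNIV (lambda_system UNIV UNIV \<mu>) \<mu>"
    by (rule caratheodory_lemma[OF outer])
  then interpret L: sigma_algebra UNIV "lambda_system UNIV UNIV \<mu>"
    by (simp add: measure_space_def)
  have "Collect closed \<subseteq> lambda_system UNIV UNIV \<mu>"
    using closed_measurable by blast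
  then have "sets borel \<subseteq> lambda_system UNIV UNIV \<mu>"
    unfolding borel_eq_closed by (simp add: L.sigma_sets_subset)
  with ms show ?thesis
    unfolding measure_space_def countably_additive_def by blast
qed

end

section \<open>The Hausdorff outer measure\<close>

lemma fine_coversD:
  assumes "\<U> \<in> fine_covers \<epsilon> K" "U \<in> \<U>"
  shows "diameter U < \<epsilon>" "bounded U"
proof -
  have "ennreal (diameter U) \<le> mesh \<U>"
    unfolding mesh_def using assms by (intro SUP_upper)
  also have "\<dots> < ennreal \<epsilon>" using assms by (simp add: fine_covers_def)
  finally have "ennreal (diameter U) < ennreal \<epsilon>" .
  moreover show "bounded U" using assms by (simp add: fine_covers_def)
  ultimately show "diameter U < \<epsilon>"
    using diameter_ge_0[of U] by (simp add: ennreal_less_iff)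
qed

lemma fine_covers_mono:
  assumes "A \<subseteq> B"
  shows "fine_covers \<epsilon> B \<subseteq> fine_covers \<epsilon> A"
  using assms by (auto simp: fine_covers_def)

lemma fine_covers_subset:
  assumes "\<U> \<in> fine_covers \<epsilon> K" "\<V> \<subseteq> \<U>" "A \<subseteq> \<Union>\<V>"
  shows "\<V> \<in> fine_covers \<epsilon> A"
proof -
  have "mesh \<V> \<le> mesh \<U>"
    unfolding mesh_def using assms by (intro SUP_subset_mono) auto
  with assms show ?thesis
    by (auto simp: fine_covers_def intro: countable_subset le_less_trans)
qed

lemma hausdorff_premeasure_le: "0 < \<epsilon> \<Longrightarrow> hausdorff_premeasure d \<epsilon> K \<le> hausdorff d K"
  unfolding hausdorff_eq_SUP by (intro SUP_upper) simp

lemma tendsto_hausdorff: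
  "((\<lambda>\<epsilon>. hausdorff_premeasure d \<epsilon> K) \<longlongrightarrow> hausdorff d K) (at_right 0)"
  unfolding hausdorff_eq_SUP by (rule tendsto_hausdorff_premeasure)

text \<open>Subadditivity comes from uniting nearly optimal covers with geometrically decreasing
  errors. Superadditivity holds because a set of diameter below the gap cannot meet both
  parts.\<close>

interpretation hausdorff: metric_outer_measure "hausdorff d" for d
proof
  have "hausdorff_premeasure d \<epsilon> {} \<le> 0" if "0 < \<epsilon>" for \<epsilon>
    unfolding hausdorff_premeasure_def using that
    \<comment> \<open>The empty family covers \<open>{}\<close>, and its mesh is \<open>0\<close>, a
      supremum over nothing being the bottom of \<open>ennreal\<close>.\<close>
    by (intro INF_lower2[of "{}"]) (auto simp: fine_covers_def mesh_def bot_ennreal)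
  then have "hausdorff d {} \<le> 0"
    unfolding hausdorff_eq_SUP by (intro SUP_least) simp
  then show "hausdorff d {} = 0" by simp
next
  fix A B :: "'a set" assume "A \<subseteq> B"
  then show "hausdorff d A \<le> hausdorff d B"
    unfolding hausdorff_eq_SUP hausdorff_premeasure_def
    by (intro SUP_mono' INF_superset_mono fine_covers_mono) auto
next
  fix X :: "nat \<Rightarrow> 'a set"
  have "hausdorff_premeasure d \<epsilon> (\<Union>n. X n) \<le> (\<Sum>n. hausdorff d (X n))" if \<epsilon>: "0 < \<epsilon>" for \<epsilon>
  proof -
    \<comment> \<open>Only the non-strict bound on the mesh survives a countable union of covers, hence the
      detour through \<open>\<epsilon> / 2\<close>.\<close>
    let ?h = "hausdorff_premeasure d (\<epsilon> / 2)"
    let ?s = "infsum (\<lambda>U. ennreal (diameter U powr d))"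
    have "hausdorff_premeasure d \<epsilon> (\<Union>n. X n) \<le> (\<Sum>n. ?h (X n))"
    proof (rule ennreal_le_epsilon)
      fix e :: real assume e: "0 < e" and fin: "(\<Sum>n. ?h (X n)) < top"
      \<comment> \<open>The errors add up to \<open>e\<close>. Finiteness of the series makes each
        summand finite, so that adding an error is a strict increase and a cover below it
        exists.\<close>
      have "\<exists>\<U>\<in>fine_covers (\<epsilon> / 2) (X n). ?s \<U> < ?h (X n) + ennreal (e * (1 / 2) ^ Suc n)" for n
      proof -
        have "?h (X n) < top"
          using ennreal_suminf_lessD[OF fin] by simp
        then have "?h (X n) < ?h (X n) + ennreal (e * (1 / 2) ^ Suc n)"
          using e by (cases "?h (X n)") (auto simp: ennreal_less_iff simp flip: ennreal_plus)
        then show ?thesis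
          unfolding hausdorff_premeasure_def[of d "\<epsilon> / 2"] INF_less_iff .
      qed
      then obtain \<U> where \<U>: "\<And>n. \<U> n \<in> fine_covers (\<epsilon> / 2) (X n)"
          "\<And>n. ?s (\<U> n) < ?h (X n) + ennreal (e * (1 / 2) ^ Suc n)"
        by metis
      have "mesh (\<Union>n. \<U> n) \<le> ennreal (\<epsilon> / 2)"
        unfolding mesh_def using fine_coversD(1)[OF \<U>(1)]
        by (intro SUP_least ennreal_leI) (auto intro: less_imp_le)
      also have "\<dots> < ennreal \<epsilon>" using \<epsilon> by (intro ennreal_lessI) auto
      finally have "(\<Union>n. \<U> n) \<in> fine_covers \<epsilon> (\<Union>n. X n)"
        using \<U>(1) by (fastforce simp: fine_covers_def)
      then have "hausdorff_premeasure d \<epsilon> (\<Union>n. X n) \<le> ?s (\<Union>n. \<U> n)"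
        unfolding hausdorff_premeasure_def by (rule INF_lower)
      also have "\<dots> \<le> (\<Sum>n. ?s (\<U> n))" by (rule infsum_UN_le_suminf)
      also have "\<dots> \<le> (\<Sum>n. ?h (X n) + ennreal (e * (1 / 2) ^ Suc n))"
        using \<U>(2) by (intro suminf_le) (auto intro: less_imp_le)
      also have "\<dots> = (\<Sum>n. ?h (X n)) + (\<Sum>n. ennreal (e * (1 / 2) ^ Suc n))"
        by (intro suminf_add[symmetric]) auto
      also have "(\<Sum>n. ennreal (e * (1 / 2) ^ Suc n)) = ennreal e"
        using e sums_mult[OF power_half_series, of e]
        by (intro suminf_ennreal_eq) auto
      finally show "hausdorff_premeasure d \<epsilon> (\<Union>n. X n) \<le> (\<Sum>n. ?h (X n)) + ennreal e" .
    qed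
    also have "\<dots> \<le> (\<Sum>n. hausdorff d (X n))"
      using \<epsilon> by (intro suminf_le hausdorff_premeasure_le) auto
    finally show ?thesis .
  qed
  then show "hausdorff d (\<Union>n. X n) \<le> (\<Sum>n. hausdorff d (X n))"
    unfolding hausdorff_eq_SUP[of d "\<Union>n. X n"] by (intro SUP_least) auto
next
  fix e :: real and A B :: "'a set"
  assume e: "0 < e" and sep: "\<And>x y. x \<in> A \<Longrightarrow> y \<in> B \<Longrightarrow> e \<le> dist x y"
  have "hausdorff_premeasure d \<epsilon> A + hausdorff_premeasure d \<epsilon> B \<le> hausdorff_premeasure d \<epsilon> (A \<union> B)"
    if \<epsilon>: "\<epsilon> < e" for \<epsilon>
    unfolding hausdorff_premeasure_def[of d \<epsilon> "A \<union> B"]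
  proof (rule INF_greatest)
    fix \<U> assume \<U>: "\<U> \<in> fine_covers \<epsilon> (A \<union> B)"
    \<comment> \<open>Discarding the members that miss \<open>S\<close> makes \<open>\<V> A\<close>
      and \<open>\<V> B\<close> disjoint: a common member would contain points at distance at least
      \<open>e > \<epsilon>\<close>.\<close>
    define \<V> where "\<V> S = {U\<in>\<U>. U \<inter> S \<noteq> {}}" for S
    have V: "\<V> S \<in> fine_covers \<epsilon> S" if "S \<subseteq> A \<union> B" for S
    proof (rule fine_covers_subset[OF \<U>])
      have "S \<subseteq> \<Union>\<U>" using that \<U> by (auto simp: fine_covers_def)
      then show "S \<subseteq> \<Union>(\<V> S)" by (auto simp: \<V>_def)
    qed (auto simp: \<V>_def)
    have "hausdorff_premeasure d \<epsilon> A + hausdorff_premeasure d \<epsilon> B \<le>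
        (\<Sum>\<^sub>\<infinity>U\<in>\<V> A. ennreal (diameter U powr d)) + (\<Sum>\<^sub>\<infinity>U\<in>\<V> B. ennreal (diameter U powr d))"
      unfolding hausdorff_premeasure_def by (intro add_mono INF_lower V) auto
    also have "\<dots> \<le> (\<Sum>\<^sub>\<infinity>U\<in>\<U>. ennreal (diameter U powr d))"
    proof (rule infsum_ennreal_Un_disjoint_le)
      have False if UV: "U \<in> \<V> A" "U \<in> \<V> B" for U
      proof -
        obtain x y where xy: "x \<in> U" "x \<in> A" "y \<in> U" "y \<in> B" and U: "U \<in> \<U>"
          using UV unfolding \<V>_def by blast
        have "e \<le> dist x y" using xy sep by auto
        also have "\<dots> \<le> diameter U"
          using xy fine_coversD(2)[OF \<U> U] by (intro diameter_bounded_bound)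
        also have "\<dots> < \<epsilon>" using \<U> U by (rule fine_coversD)
        finally show False using \<epsilon> by simp
      qed
      then show "\<V> A \<inter> \<V> B = {}" by auto
    qed (auto simp: \<V>_def)
    finally show "hausdorff_premeasure d \<epsilon> A + hausdorff_premeasure d \<epsilon> B \<le>
        (\<Sum>\<^sub>\<infinity>U\<in>\<U>. ennreal (diameter U powr d))" .
  qed
  then have "\<forall>\<^sub>F \<epsilon> in at_right 0. hausdorff_premeasure d \<epsilon> A + hausdorff_premeasure d \<epsilon> B \<le>
      hausdorff_premeasure d \<epsilon> (A \<union> B)"
    unfolding eventually_at_right_field using e by auto
  then show "hausdorff d A + hausdorff d B \<le> hausdorff d (A \<union> B)"
    by (rule tendsto_le[rotated 3]) (auto intro!: tendsto_hausdorff tendsto_add)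
qed

section \<open>Hausdorff measure on the Borel sets, and dimension\<close>

lemma sets_hausdorff_measure [simp, measurable_cong]: "sets (hausdorff_measure d) = sets borel"
  using sets.sigma_sets_eq[of "borel :: 'a measure"]
  by (simp add: hausdorff_measure_def sets_measure_of_conv)

lemma space_hausdorff_measure [simp]: "space (hausdorff_measure d) = UNIV"
  by (simp add: hausdorff_measure_def space_measure_of_conv)

text \<open>Caratheodory's criterion enters here: \<open>measure_of\<close> falls back to the zero
  measure unless the given set function is countably additive.\<close>

lemma emeasure_hausdorff_measure:
  assumes "A \<in> sets borel"
  shows "emeasure (hausdorff_measure d) A = hausdorff d A"
  unfolding hausdorff_measure_def
  using assms sets.sigma_algebra_axioms[of "borel :: 'a measure"]
  by (intro emeasure_measure_of_sigma hausdorff.countably_additive_borel)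
     (auto simp: positive_def hausdorff.empty)

text \<open>In a cover of mesh below \<open>\<epsilon>\<close>, raising the exponent from
  \<open>d\<close> to \<open>d'\<close> gains a factor \<open>\<epsilon> powr (d' - d)\<close>,
  which tends to zero.\<close>

lemma hausdorff_eq_0:
  assumes "d < d'" "hausdorff d K < \<infinity>"
  shows "hausdorff d' K = 0"
proof -
  \<comment> \<open>The added \<open>1\<close> gives a strict upper bound, so that some cover has a
    sum below \<open>C\<close>.\<close>
  define C where "C = enn2real (hausdorff d K) + 1"
  have C: "hausdorff d K < ennreal C"
    using assms(2) unfolding C_def
    by (cases "hausdorff d K") (auto simp: ennreal_less_iff)
  have le: "hausdorff_premeasure d' \<epsilon> K \<le> ennreal (\<epsilon> powr (d' - d) * C)" if \<epsilon>: "0 < \<epsilon>" for \<epsilon>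
  proof -
    have "hausdorff_premeasure d \<epsilon> K < ennreal C"
      using C hausdorff_premeasure_le[OF \<epsilon>, of d K] by (rule le_less_trans[rotated])
    then obtain \<U> where \<U>: "\<U> \<in> fine_covers \<epsilon> K"
        and less: "(\<Sum>\<^sub>\<infinity>U\<in>\<U>. ennreal (diameter U powr d)) < ennreal C"
      unfolding hausdorff_premeasure_def INF_less_iff by auto
    have "hausdorff_premeasure d' \<epsilon> K \<le> (\<Sum>\<^sub>\<infinity>U\<in>\<U>. ennreal (diameter U powr d'))"
      unfolding hausdorff_premeasure_def using \<U> by (rule INF_lower)
    also have "\<dots> \<le> ennreal (\<epsilon> powr (d' - d) * C)"
    proof (rule infsum_ennreal_le)
      fix F assume F: "finite F" "F \<subseteq> \<U>"
      have "(\<Sum>U\<in>F. ennreal (diameter U powr d')) \<le>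
          (\<Sum>U\<in>F. ennreal (\<epsilon> powr (d' - d)) * ennreal (diameter U powr d))"
      proof (rule sum_mono)
        fix U assume "U \<in> F"
        then have U: "0 \<le> diameter U" "diameter U < \<epsilon>"
          using F fine_coversD[OF \<U>] diameter_ge_0 by auto
        have "diameter U powr d' = diameter U powr (d' - d) * diameter U powr d"
          by (simp flip: powr_add)
        also have "\<dots> \<le> \<epsilon> powr (d' - d) * diameter U powr d"
          using U assms(1) by (intro mult_right_mono powr_mono2) auto
        finally show "ennreal (diameter U powr d') \<le>
            ennreal (\<epsilon> powr (d' - d)) * ennreal (diameter U powr d)"
          by (simp add: ennreal_leI flip: ennreal_mult)
      qed
      also have "\<dots> = ennreal (\<epsilon> powr (d' - d)) * (\<Sum>U\<in>F. ennreal (diameter U powr d))"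
        by (rule sum_distrib_left[symmetric])
      also have "(\<Sum>U\<in>F. ennreal (diameter U powr d)) \<le> (\<Sum>\<^sub>\<infinity>U\<in>\<U>. ennreal (diameter U powr d))"
        using F by (rule sum_le_infsum_ennreal)
      also have "\<dots> \<le> ennreal C" using less by (rule less_imp_le)
      also have "ennreal (\<epsilon> powr (d' - d)) * ennreal C = ennreal (\<epsilon> powr (d' - d) * C)"
        by (simp add: C_def ennreal_mult)
      finally show "(\<Sum>U\<in>F. ennreal (diameter U powr d')) \<le> ennreal (\<epsilon> powr (d' - d) * C)"
        by (simp add: mult_left_mono)
    qed
    finally show ?thesis .
  qed
  have "((\<lambda>\<epsilon>::real. \<epsilon> powr (d' - d) * C) \<longlongrightarrow> 0 powr (d' - d) * C) (at_right 0)"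
    using assms(1) by (intro tendsto_intros tendsto_powr' tendsto_ident_at)
      (auto simp: eventually_at_right_less[THEN eventually_mono])
  then have "((\<lambda>\<epsilon>. ennreal (\<epsilon> powr (d' - d) * C)) \<longlongrightarrow> 0) (at_right 0)"
    using tendsto_ennrealI by fastforce
  moreover have "\<forall>\<^sub>F \<epsilon> in at_right 0. hausdorff_premeasure d' \<epsilon> K \<le> ennreal (\<epsilon> powr (d' - d) * C)"
    using le by (auto simp: eventually_at_right_field intro: exI[of _ 1])
  ultimately have "hausdorff d' K \<le> 0"
    by (intro tendsto_le[OF _ _ tendsto_hausdorff]) auto
  then show ?thesis by simp
qed

text \<open>Exponents below \<open>d\<close> give \<open>\<infinity>\<close>, since a finite value
  there would force the value \<open>0\<close> at \<open>d\<close>. Uniqueness follows by evaluating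
  at \<open>d\<close> itself: any other \<open>d0\<close> would make \<open>hausdorff d K\<close>
  either \<open>0\<close> or \<open>\<infinity>\<close>.\<close>

lemma hausdorff_dim_eq:
  assumes "0 < d" "0 < hausdorff d K" "hausdorff d K < \<infinity>"
  shows "hausdorff_dim K = d"
  unfolding hausdorff_dim_def
proof (rule the_equality)
  have "hausdorff d' K = \<infinity>" if "d' < d" for d'
    using hausdorff_eq_0[OF that, of K] assms(2) by (metis infinity_ennreal_def less_irrefl less_top)
  then show "0 \<le> d \<and> (\<forall>d'. 0 < d' \<and> d' < d \<longrightarrow> hausdorff d' K = \<infinity>) \<and> (\<forall>d'>d. hausdorff d' K = 0)"
    using assms hausdorff_eq_0[of d _ K] by auto
next
  fix d0 assume d0: "0 \<le> d0 \<and> (\<forall>d. 0 < d \<and> d < d0 \<longrightarrow> hausdorff d K = \<infinity>) \<and> (\<forall>d>d0. hausdorff d K = 0)"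
  then have "\<not> d0 < d" "\<not> d < d0" using assms by auto
  then show "d0 = d" by simp
qed

section \<open>Orthogonal projections and Lebesgue measure on subspaces\<close>

lemma orthonormal_basis_of_finite:
  assumes "orthonormal_basis_of \<pi> B"
  shows "finite B" "card B = dim \<pi>"
proof -
  have "independent B"
    using assms pairwise_orthogonal_independent[of B] by (force simp: orthonormal_basis_of_def)
  then show "finite B" "card B = dim \<pi>"
    using assms dim_span_eq_card_independent[of B]
    by (auto simp: orthonormal_basis_of_def independent_imp_finite)
qed

lemma orthonormal_basis_of_inner_sum:
  assumes "orthonormal_basis_of \<pi> B" "b \<in> B"
  shows "(\<Sum>a\<in>B. f a *\<^sub>R a) \<bullet> b = f b"
proof -
  have "(\<Sum>a\<in>B. f a *\<^sub>R a) \<bullet> b = (\<Sum>a\<in>B. if a = b then f a else 0)"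
    unfolding inner_sum_left using assms
    by (intro sum.cong)
       (auto simp: orthonormal_basis_of_def pairwise_def orthogonal_def norm_eq_1)
  then show ?thesis
    using assms orthonormal_basis_of_finite[OF assms(1)] by simp
qed

lemma orthonormal_basis_of_sum_in:
  assumes "orthonormal_basis_of \<pi> B"
  shows "(\<Sum>a\<in>B. f a *\<^sub>R a) \<in> \<pi>"
proof -
  have "(\<Sum>a\<in>B. f a *\<^sub>R a) \<in> span B"
    by (intro span_sum span_scale span_base)
  then show ?thesis using assms by (simp add: orthonormal_basis_of_def)
qed

text \<open>For uniqueness, the difference of two candidates lies in \<open>\<pi>\<close> and is
  orthogonal to both residuals, hence to itself.\<close>

lemma orth_projection_eq_sum:
  assumes B: "orthonormal_basis_of \<pi> B"
  shows "orth_projection \<pi> x = (\<Sum>b\<in>B. (x \<bullet> b) *\<^sub>R b)"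
  unfolding orth_projection_def
proof (rule the_equality)
  let ?y = "\<Sum>b\<in>B. (x \<bullet> b) *\<^sub>R b"
  have "orthogonal (x - ?y) z" if "z \<in> \<pi>" for z
  proof (rule orthogonal_to_span)
    show "z \<in> span B" using B that by (simp add: orthonormal_basis_of_def)
    show "orthogonal (x - ?y) b" if "b \<in> B" for b
      using orthonormal_basis_of_inner_sum[OF B that, of "\<lambda>b. x \<bullet> b"]
      by (simp add: orthogonal_def inner_diff_left)
  qed
  then show y: "?y \<in> \<pi> \<and> (\<forall>z\<in>\<pi>. orthogonal (x - ?y) z)"
    using orthonormal_basis_of_sum_in[OF B] by blast
  fix y assume y': "y \<in> \<pi> \<and> (\<forall>z\<in>\<pi>. orthogonal (x - y) z)"
  have "y - ?y \<in> \<pi>"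
    using y y' B by (auto simp: orthonormal_basis_of_def intro: span_diff)
  then have "orthogonal (x - ?y) (y - ?y)" "orthogonal (x - y) (y - ?y)"
    using y y' by auto
  then have "(y - ?y) \<bullet> (y - ?y) = 0"
    by (simp add: orthogonal_def inner_diff_left)
  then show "y = ?y" by simp
qed

text \<open>The point \<open>x\<close> need not lie in \<open>\<pi>\<close>: for \<open>B\<close> an
  orthonormal basis of \<open>\<pi>\<close> the cube is centred at its projection. Cubes are boxes
  in the coordinates of \<open>B\<close>, so their volume is explicit.\<close>

definition subspace_cube :: "'a::euclidean_space set \<Rightarrow> 'a set \<Rightarrow> 'a \<Rightarrow> real \<Rightarrow> 'a set" where
  "subspace_cube \<pi> B x r = {y\<in>\<pi>. \<forall>b\<in>B. \<bar>(y - x) \<bullet> b\<bar> \<le> r}"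

lemma sets_subspace_lborel [simp, measurable_cong]:
  "sets (subspace_lborel \<pi>) = sets (restrict_space borel \<pi>)"
  by (simp add: subspace_lborel_def Let_def)

lemma subspace_cube_sets:
  assumes "orthonormal_basis_of \<pi> B"
  shows "subspace_cube \<pi> B x r \<in> sets (restrict_space borel \<pi>)"
proof -
  have [measurable]: "finite B" by (rule orthonormal_basis_of_finite[OF assms])
  have "{y. \<forall>b\<in>B. \<bar>(y - x) \<bullet> b\<bar> \<le> r} = (\<Inter>b\<in>B. {y. \<bar>(y - x) \<bullet> b\<bar> \<le> r})"
    by auto
  moreover have "closed \<dots>"
    by (intro closed_INT ballI closed_Collect_le continuous_intros)
  ultimately have "{y. \<forall>b\<in>B. \<bar>(y - x) \<bullet> b\<bar> \<le> r} \<in> sets borel" by simp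
  then show ?thesis
    unfolding subspace_cube_def sets_restrict_space
    by (intro image_eqI[where x = "{y. \<forall>b\<in>B. \<bar>(y - x) \<bullet> b\<bar> \<le> r}"]) auto
qed

text \<open>\<open>B\<close> is the very basis chosen in \<open>subspace_lborel\<close>, so the
  preimage of the cube under the coordinate map is a product of intervals of length
  \<open>2 * r\<close>.\<close>

lemma emeasure_subspace_cube:
  fixes \<pi> :: "'a::euclidean_space set"
  assumes \<pi>: "subspace \<pi>" and r: "0 \<le> r"
  defines "B \<equiv> SOME B. orthonormal_basis_of \<pi> B"
  shows "emeasure (subspace_lborel \<pi>) (subspace_cube \<pi> B x r) = ennreal ((2 * r) ^ dim \<pi>)"
proof -
  have B: "orthonormal_basis_of \<pi> B"
    unfolding B_def using orthonormal_basis_of_exists[OF \<pi>] by (rule someI_ex)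
  note fin = orthonormal_basis_of_finite[OF B]
  interpret product_sigma_finite "\<lambda>_::'a. lborel :: real measure" ..
  let ?P = "\<Pi>\<^sub>M b\<in>B. (lborel :: real measure)"
  let ?T = "\<lambda>f. \<Sum>b\<in>B. f b *\<^sub>R b"
  have T: "?T \<in> measurable ?P (restrict_space borel \<pi>)"
    using orthonormal_basis_of_sum_in[OF B] by (intro measurable_restrict_space2) auto
  have "emeasure (subspace_lborel \<pi>) (subspace_cube \<pi> B x r) =
      emeasure ?P (?T -` subspace_cube \<pi> B x r \<inter> space ?P)"
    unfolding subspace_lborel_def Let_def B_def[symmetric]
    by (intro emeasure_distr T subspace_cube_sets B)
  also have "?T -` subspace_cube \<pi> B x r \<inter> space ?P = (\<Pi>\<^sub>E b\<in>B. {x \<bullet> b - r .. x \<bullet> b + r})"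
    using orthonormal_basis_of_sum_in[OF B]
    by (auto simp: subspace_cube_def space_PiM PiE_iff inner_diff_left abs_le_iff
        orthonormal_basis_of_inner_sum[OF B]) (force simp: algebra_simps)+
  also have "emeasure ?P \<dots> = (\<Prod>b\<in>B. emeasure lborel {x \<bullet> b - r .. x \<bullet> b + r})"
    using fin by (intro emeasure_PiM) auto
  also have "\<dots> = (\<Prod>b\<in>B. ennreal (2 * r))"
    using r by (intro prod.cong) auto
  also have "\<dots> = ennreal ((2 * r) ^ dim \<pi>)"
    using r fin by (simp add: ennreal_power)
  finally show ?thesis .
qed

text \<open>Cubes of integer size around the origin exhaust \<open>\<pi>\<close>. This gives access
  to the Radon-Nikodym derivative.\<close>

lemma sigma_finite_subspace_lborel:
  fixes \<pi> :: "'a::euclidean_space set"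
  assumes \<pi>: "subspace \<pi>"
  shows "sigma_finite_measure (subspace_lborel \<pi>)"
proof
  define B where "B = (SOME B. orthonormal_basis_of \<pi> B)"
  have B: "orthonormal_basis_of \<pi> B"
    unfolding B_def using orthonormal_basis_of_exists[OF \<pi>] by (rule someI_ex)
  let ?A = "range (\<lambda>n::nat. subspace_cube \<pi> B 0 (real n))"
  have sp: "space (subspace_lborel \<pi>) = \<pi>"
    using sets_eq_imp_space_eq[OF sets_subspace_lborel, of \<pi>] by (simp add: space_restrict_space)
  have "y \<in> \<Union>?A" if "y \<in> \<pi>" for y
  proof -
    obtain n :: nat where n: "norm y \<le> real n" using real_arch_simple by blast
    have "\<bar>y \<bullet> b\<bar> \<le> real n" if "b \<in> B" for b
      using n that Cauchy_Schwarz_ineq2[of y b] B by (auto simp: orthonormal_basis_of_def)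
    then show ?thesis using that by (auto simp: subspace_cube_def)
  qed
  then have "\<Union>?A = space (subspace_lborel \<pi>)"
    unfolding sp by (auto simp: subspace_cube_def)
  moreover have "\<forall>a\<in>?A. emeasure (subspace_lborel \<pi>) a \<noteq> \<infinity>"
    using emeasure_subspace_cube[OF \<pi>] by (auto simp: B_def)
  moreover have "?A \<subseteq> sets (subspace_lborel \<pi>)"
    using subspace_cube_sets[OF B] by auto
  moreover have "countable ?A" by simp
  ultimately show "\<exists>A. countable A \<and> A \<subseteq> sets (subspace_lborel \<pi>) \<and>
      \<Union> A = space (subspace_lborel \<pi>) \<and> (\<forall>a\<in>A. emeasure (subspace_lborel \<pi>) a \<noteq> \<infinity>)"
    by blast
qed

section \<open>The projected measure\<close>

lemma measurable_orth_projection: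
  fixes \<pi> :: "'a::euclidean_space set"
  assumes "subspace \<pi>"
  shows "orth_projection \<pi> \<in> measurable (restrict_space (hausdorff_measure d) K) (restrict_space borel \<pi>)"
proof -
  obtain B where B: "orthonormal_basis_of \<pi> B"
    using orthonormal_basis_of_exists[OF assms] by blast
  have "orth_projection \<pi> \<in> borel_measurable borel"
    unfolding orth_projection_eq_sum[OF B, abs_def] by measurable
  then have "orth_projection \<pi> \<in> borel_measurable (hausdorff_measure d)"
    by (simp cong: measurable_cong_sets)
  then show ?thesis
    using orthonormal_basis_of_sum_in[OF B]
    by (intro measurable_restrict_space2 measurable_restrict_space1)
       (auto simp: orth_projection_eq_sum[OF B])
qed

lemma emeasure_projected_measure:
  fixes \<pi> :: "'a::euclidean_space set"
  assumes "subspace \<pi>" and K: "K \<in> sets borel" and A: "A \<in> sets (restrict_space borel \<pi>)"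
  shows "emeasure (projected_measure d K \<pi>) A = hausdorff d (orth_projection \<pi> -` A \<inter> K)"
proof -
  let ?R = "restrict_space (hausdorff_measure d) K"
  let ?S = "orth_projection \<pi> -` A \<inter> K"
  have sp: "space ?R = K" by (simp add: space_restrict_space)
  have "?S \<in> sets ?R"
    using measurable_sets[OF measurable_orth_projection[OF assms(1), where d = d and K = K] A]
    by (simp add: sp)
  then have S: "?S \<in> sets borel"
    using K by (simp add: sets_restrict_space_iff)
  have "emeasure (projected_measure d K \<pi>) A = emeasure ?R ?S"
    unfolding projected_measure_def
    by (subst emeasure_distr[OF measurable_orth_projection[OF assms(1)] A]) (simp add: sp)
  also have "\<dots> = emeasure (hausdorff_measure d) ?S"
    using K by (intro emeasure_restrict_space) auto
  finally show ?thesis using S by (simp add: emeasure_hausdorff_measure)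
qed

text \<open>Projecting does not change inner products with basis vectors, so Cauchy-Schwarz bounds
  each coordinate by the distance.\<close>

lemma orth_projection_in_cube:
  assumes B: "orthonormal_basis_of \<pi> B" and "dist x y \<le> r"
  shows "orth_projection \<pi> y \<in> subspace_cube \<pi> B x r"
proof -
  have "\<bar>(orth_projection \<pi> y - x) \<bullet> b\<bar> \<le> r" if b: "b \<in> B" for b
  proof -
    have "(orth_projection \<pi> y - x) \<bullet> b = (y - x) \<bullet> b"
      using orthonormal_basis_of_inner_sum[OF B b, of "\<lambda>b. y \<bullet> b"]
      by (simp add: orth_projection_eq_sum[OF B] inner_diff_left)
    also have "\<bar>\<dots>\<bar> \<le> norm (y - x) * norm b" by (rule Cauchy_Schwarz_ineq2)
    also have "\<dots> \<le> r"
      using B b assms(2) by (simp add: orthonormal_basis_of_def dist_norm norm_minus_commute)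
    finally show ?thesis .
  qed
  then show ?thesis
    using orthonormal_basis_of_sum_in[OF B]
    by (simp add: subspace_cube_def orth_projection_eq_sum[OF B])
qed

section \<open>Measures with an \<open>L\<^sup>p\<close> density\<close>

text \<open>A bound of Hoelder type. A single \<open>C\<close> serves all sets \<open>A\<close>, so
  it can be applied to infinitely many cubes at once.\<close>

lemma (in sigma_finite_measure) in_Lp_RN_deriv_emeasure_le:
  assumes N: "finite_measure N" "absolutely_continuous M N" "sets N = sets M"
    and p: "1 < p" and Lp: "in_Lp p M (\<lambda>x. enn2real (RN_deriv M N x))"
  shows "\<exists>C. \<forall>A m. A \<in> sets M \<longrightarrow> 0 < m \<longrightarrow> emeasure M A = ennreal m \<longrightarrow>
    emeasure N A \<le> ennreal (C * m powr (1 - 1 / p))"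
proof -
  interpret N: finite_measure N by fact
  define f where "f x = enn2real (RN_deriv M N x)" for x
  have f0: "f x \<ge> 0" for x by (simp add: f_def)
  have [measurable]: "f \<in> borel_measurable M" unfolding f_def by measurable
  have int: "integrable M (\<lambda>x. f x powr p)"
    using Lp by (simp add: in_Lp_def f_def)
  define I where "I = (\<integral>x. f x powr p \<partial>M)"
  have I0: "I \<ge> 0" unfolding I_def by simp
  have I: "(\<integral>\<^sup>+x. ennreal (f x powr p) \<partial>M) = ennreal I"
    unfolding I_def using int by (intro nn_integral_eq_integral) auto
  \<comment> \<open>\<open>enn2real\<close> would send an infinite density to \<open>0\<close>; as
    \<open>N\<close> is finite, that can happen only on a null set.\<close>
  have ae: "AE x in M. RN_deriv M N x = ennreal (f x)"
    using RN_deriv_finite[OF N.sigma_finite_measure_axioms N(2,3)]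
    by eventually_elim (simp add: f_def less_top)
  have "emeasure N A \<le> ennreal ((1 + I) * m powr (1 - 1 / p))"
    if A [measurable]: "A \<in> sets M" and m: "0 < m" and mA: "emeasure M A = ennreal m" for A m
  proof -
    define t where "t = m powr (- (1 / p))"
    have t: "t > 0" using m by (simp add: t_def)
    \<comment> \<open>This replaces Hoelder's inequality; \<open>t\<close> is chosen to make both terms integrate to the
      same power of \<open>m\<close>.\<close>
    have split: "f x \<le> t + t powr (1 - p) * f x powr p" for x
    proof (cases "f x \<le> t")
      case True
      then show ?thesis using t by (simp add: add_increasing2)
    next
      case False
      then have pos: "0 < f x" using t by simp
      \<comment> \<open>The exponent \<open>1 - p\<close> is negative, so the first factor grows
        when \<open>f x\<close> is replaced by the smaller \<open>t\<close>.\<close>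
      have "f x = f x powr (1 - p) * f x powr p"
        using pos by (simp flip: powr_add)
      also have "\<dots> \<le> t powr (1 - p) * f x powr p"
        using False t p by (intro mult_right_mono powr_mono2') auto
      finally show ?thesis using t by simp
    qed
    have "emeasure N A = emeasure (density M (RN_deriv M N)) A"
      using density_RN_deriv[OF N(2,3)] by simp
    also have "\<dots> = (\<integral>\<^sup>+x. RN_deriv M N x * indicator A x \<partial>M)"
      by (rule emeasure_density) auto
    \<comment> \<open>The second term is integrated over the whole space, which gives the fixed
      constant \<open>I\<close>.\<close>
    also have "\<dots> \<le> (\<integral>\<^sup>+x. ennreal t * indicator A x + ennreal (t powr (1 - p)) * ennreal (f x powr p) \<partial>M)"
    proof (rule nn_integral_mono_AE)
      show "AE x in M. RN_deriv M N x * indicator A x \<le>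
          ennreal t * indicator A x + ennreal (t powr (1 - p)) * ennreal (f x powr p)"
        using ae
      proof eventually_elim
        case (elim x)
        show ?case
          using split[of x] t f0[of x] elim
          by (cases "x \<in> A") (auto simp: ennreal_leI simp flip: ennreal_mult ennreal_plus)
      qed
    qed
    also have "\<dots> = ennreal t * ennreal m + ennreal (t powr (1 - p)) * ennreal I"
      by (subst nn_integral_add) (auto simp: nn_integral_cmult I mA)
    also have "\<dots> = ennreal (t * m + t powr (1 - p) * I)"
      using t m I0 by (simp add: ennreal_mult ennreal_plus)
    also have "t * m + t powr (1 - p) * I = (1 + I) * m powr (1 - 1 / p)"
    proof -
      have "t * m = m powr (1 - 1 / p)"
        using m powr_add[of m "- (1 / p)" 1] by (simp add: t_def)
      moreover have "t powr (1 - p) = m powr (1 - 1 / p)"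
        unfolding t_def powr_powr using p by (intro arg_cong2[where f = "(powr)"]) (auto simp: field_simps)
      ultimately show ?thesis by (simp add: algebra_simps)
    qed
    finally show ?thesis .
  qed
  then show ?thesis by blast
qed

section \<open>The \<open>d\<close>-set property of the union, and the failure of \<open>L^p\<close>
  densities\<close>

theorem theorem1p3:
  fixes l :: nat and d :: real
    and c r :: "nat \<Rightarrow> real"
    and Kj :: "nat \<Rightarrow> (real ^ 'n) set" and K :: "(real ^ 'n) set"
  assumes "0 < l" and "l < CARD('n)"
    and "real l < d" and "d < real CARD('n)"
    and "\<And>j. 0 < c j" and "\<And>j. 0 < r j"
    and "summable (\<lambda>j. c j * r j powr d)"
    and "\<And>\<epsilon>. 0 < \<epsilon> \<Longrightarrow> filterlim (\<lambda>j. c j * r j powr (d - \<epsilon>)) at_top sequentially"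
    and "disjoint_family Kj"
    and "\<And>j. d_set d (Kj j)"
    and "\<And>j. bounded (Kj j)" and "\<And>j. diameter (Kj j) \<le> r j"
    and "\<And>j. hausdorff d (Kj j) = ennreal (c j * r j powr d)"
    and "K = (\<Union>j. Kj j)"
  shows "d_set d K \<and> 0 < hausdorff d K \<and> hausdorff d K < \<infinity> \<and>
    (\<forall>\<pi> \<in> grassmannian l.
       absolutely_continuous (subspace_lborel \<pi>) (projected_measure d K \<pi>) \<longrightarrow>
       (\<forall>p>1. \<not> in_Lp p (subspace_lborel \<pi>)
          (\<lambda>x. enn2real (RN_deriv (subspace_lborel \<pi>) (projected_measure d K \<pi>) x))))"
proof -
  have d: "0 < d" using assms(1,3) by linarith
  have Kj: "Kj j \<in> sets borel" for j using assms(10) by (simp add: d_set_def)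
  then have K: "K \<in> sets borel" unfolding assms(14) by auto
  have sub: "Kj j \<subseteq> K" for j unfolding assms(14) by auto
  have pos: "0 < c j * r j powr d" for j using assms(5)[of j] assms(6)[of j] by simp
  have "hausdorff d K \<le> (\<Sum>j. hausdorff d (Kj j))"
    unfolding assms(14) by (rule hausdorff.UN_le)
  also have "\<dots> < \<infinity>"
    using ennreal_suminf_neq_top[OF assms(7) less_imp_le[OF pos]]
    unfolding assms(13) infinity_ennreal_def by (rule top.not_eq_extremum[THEN iffD1])
  finally have fin: "hausdorff d K < \<infinity>" .
  have Kj_gt0: "0 < hausdorff d (Kj j)" for j
    unfolding assms(13) ennreal_less_zero_iff by (rule pos)
  have "0 < hausdorff d (Kj 0)" by (rule Kj_gt0)
  also have "\<dots> \<le> hausdorff d K" using sub by (rule hausdorff.mono)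
  finally have gt0: "0 < hausdorff d K" .
  have "d_set d K"
    unfolding d_set_def using K fin gt0 hausdorff_dim_eq[OF d] by simp
  moreover have "\<not> in_Lp p (subspace_lborel \<pi>)
          (\<lambda>x. enn2real (RN_deriv (subspace_lborel \<pi>) (projected_measure d K \<pi>) x))"
    if "\<pi> \<in> grassmannian l" and ac: "absolutely_continuous (subspace_lborel \<pi>) (projected_measure d K \<pi>)"
      and p: "1 < p" for \<pi> p
  proof
    let ?M = "subspace_lborel \<pi>" and ?N = "projected_measure d K \<pi>"
    assume Lp: "in_Lp p ?M (\<lambda>x. enn2real (RN_deriv ?M ?N x))"
    have \<pi>: "subspace \<pi>" "dim \<pi> = l" using that(1) by (auto simp: grassmannian_def)
    define B where "B = (SOME B. orthonormal_basis_of \<pi> B)"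
    have B: "orthonormal_basis_of \<pi> B"
      unfolding B_def using orthonormal_basis_of_exists[OF \<pi>(1)] by (rule someI_ex)
    interpret sigma_finite_measure ?M by (rule sigma_finite_subspace_lborel[OF \<pi>(1)])
    have sets: "sets ?N = sets ?M" by (simp add: projected_measure_def)
    have "finite_measure ?N"
    proof
      have "space ?N \<in> sets (restrict_space borel \<pi>)"
        using sets.top[of ?N] sets by simp
      then have "emeasure ?N (space ?N) \<le> hausdorff d K"
        using \<pi> K by (simp add: emeasure_projected_measure hausdorff.mono)
      then show "emeasure ?N (space ?N) \<noteq> \<infinity>" using fin by (auto simp: top_unique)
    qed
    then obtain C where C: "\<And>A m. A \<in> sets ?M \<Longrightarrow> 0 < m \<Longrightarrow> emeasure ?M A = ennreal m \<Longrightarrow>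
        emeasure ?N A \<le> ennreal (C * m powr (1 - 1 / p))"
      using in_Lp_RN_deriv_emeasure_le[OF _ ac sets p Lp] by blast
    \<comment> \<open>The cube of side \<open>2 * r j\<close> has volume
      \<open>(2 * r j) ^ l\<close>; raised to the power \<open>1 - 1 / p\<close> this is
      \<open>(2 * r j) powr e\<close>.\<close>
    define e where "e = real l * (1 - 1 / p)"
    have e: "0 < e" using assms(1) p by (simp add: e_def)
    have "c j * r j powr (d - e) \<le> C * 2 powr e" for j
    proof -
      have r: "0 < r j" by (rule assms(6))
      \<comment> \<open>Positive measure supplies a point of \<open>Kj j\<close> around which to
        place the cube.\<close>
      have "Kj j \<noteq> {}"
        using Kj_gt0[of j] by (auto simp: hausdorff.empty)
      then obtain x where x: "x \<in> Kj j" by auto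
      let ?Q = "subspace_cube \<pi> B x (r j)"
      have Q: "?Q \<in> sets (restrict_space borel \<pi>)" by (rule subspace_cube_sets[OF B])
      have "Kj j \<subseteq> orth_projection \<pi> -` ?Q \<inter> K"
      proof
        fix y assume y: "y \<in> Kj j"
        have "dist x y \<le> diameter (Kj j)"
          by (rule diameter_bounded_bound[OF assms(11) x y])
        also have "\<dots> \<le> r j" by (rule assms(12))
        finally show "y \<in> orth_projection \<pi> -` ?Q \<inter> K"
          using orth_projection_in_cube[OF B] sub[of j] y by auto
      qed
      then have "ennreal (c j * r j powr d) \<le> emeasure ?N ?Q"
        unfolding emeasure_projected_measure[OF \<pi>(1) K Q] assms(13)[symmetric]
        by (rule hausdorff.mono)
      also have "\<dots> \<le> ennreal (C * ((2 * r j) ^ l) powr (1 - 1 / p))"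
        using Q r emeasure_subspace_cube[OF \<pi>(1), of "r j" x] \<pi>(2)
        by (intro C) (auto simp: B_def)
      also have "((2 * r j) ^ l) powr (1 - 1 / p) = 2 powr e * r j powr e"
        using r by (simp add: e_def powr_mult powr_powr flip: powr_realpow)
      \<comment> \<open>The sign of \<open>C\<close> is not known and \<open>ennreal\<close>
        truncates negative numbers to \<open>0\<close>; positivity of the left side rules that case
        out.\<close>
      finally have "c j * r j powr d \<le> C * (2 powr e * r j powr e)"
        using pos[of j] unfolding ennreal_le_iff2 by linarith
      then have "c j * r j powr d / r j powr e \<le> C * 2 powr e"
        using r by (simp add: divide_le_eq mult.assoc)
      then show ?thesis by (simp add: powr_diff)
    qed
    moreover have "\<forall>\<^sub>F j in sequentially. C * 2 powr e < c j * r j powr (d - e)"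
      using assms(8)[OF e] by (simp add: filterlim_at_top_dense)
    ultimately have "\<forall>\<^sub>F j in sequentially. False"
      by (auto elim!: eventually_mono simp: not_less[symmetric])
    then show False by simp
  qed
  ultimately show ?thesis using fin gt0 by blast
qed

end
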